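(* Let $R$ be a unique factorization domain with quotient field $Q(R)$, and let $f$ and $g$ be Dirichlet polynomials with coefficients in $R$ of coprime degrees $m$ and $n$ respectively, with $m<n$. Let $p_1,\dots,p_r$ be the distinct prime factors of $m\cdot n$, let $p$ be a prime element of $R$ dividing neither the leading coefficient of $f$ nor that of $g$, and let $k$ be any positive integer with $\gcd(k,\ \nu_{p_1}(n)-\nu_{p_1}(m),\dots,\nu_{p_r}(n)-\nu_{p_r}(m))=1$. Then $f(s)+p^kg(s)$ is irreducible over $Q(R)$.
   Context: A Dirichlet polynomial is a finite sum $\sum_i\frac{a_i}{i^s}$; its degree is the largest $i$ with $a_i\ne0$ and its leading coefficient is that $a_i$. Products are Dirichlet products $\left(\sum_j\frac{b_j}{j^s}\right)\left(\sum_k\frac{c_k}{k^s}\right)=\sum_i\frac{\sum_{jk=i}b_jc_k}{i^s}$; constant means supported on $\{1\}$. Irreducible over $Q(R)$: not a product of two nonconstant Dirichlet polynomials with coefficients in $Q(R)$. $\nu_q$ denotes the $q$-adic valuation. *)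

theory Defs
  imports
    "HOL-Computational_Algebra.Computational_Algebra"
    "Berlekamp_Zassenhaus.Unique_Factorization"
begin

text \<open>
  A Dirichlet polynomial is represented by its coefficient function. Indices start at 1, so the
  value at 0 is required to be 0; this makes equality of Dirichlet polynomials equality of
  coefficient functions.
\<close>

definition dirichlet_poly :: "(nat \<Rightarrow> 'a::zero) \<Rightarrow> bool" where
  "dirichlet_poly a \<longleftrightarrow> a 0 = 0 \<and> finite {i. a i \<noteq> 0}"

text \<open>Unspecified for the zero polynomial, as \<^term>\<open>Max {}\<close> is.\<close>

definition dirichlet_degree :: "(nat \<Rightarrow> 'a::zero) \<Rightarrow> nat" where
  "dirichlet_degree a = Max {i. a i \<noteq> 0}"

definition dirichlet_lead_coeff :: "(nat \<Rightarrow> 'a::zero) \<Rightarrow> 'a" where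
  "dirichlet_lead_coeff a = a (dirichlet_degree a)"

definition dirichlet_constant :: "(nat \<Rightarrow> 'a::zero) \<Rightarrow> bool" where
  "dirichlet_constant a \<longleftrightarrow> {i. a i \<noteq> 0} \<subseteq> {1}"

definition dirichlet_mult ::
    "(nat \<Rightarrow> 'a::comm_semiring_0) \<Rightarrow> (nat \<Rightarrow> 'a) \<Rightarrow> nat \<Rightarrow> 'a" where
  "dirichlet_mult b c i = (\<Sum>(j, k) | 0 < j \<and> 0 < k \<and> j * k = i. b j * c k)"

text \<open>
  Irreducibility over the field \<^typ>\<open>'a\<close> of coefficients, to be applied with \<^typ>\<open>'a\<close> the
  quotient field of the base ring. Constant factors are the only trivial ones, and constants
  themselves are not excluded.
\<close>

definition dirichlet_irreducible :: "(nat \<Rightarrow> 'a::field) \<Rightarrow> bool" where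
  "dirichlet_irreducible h \<longleftrightarrow>
     \<not> (\<exists>u v. dirichlet_poly u \<and> dirichlet_poly v \<and>
             \<not> dirichlet_constant u \<and> \<not> dirichlet_constant v \<and> h = dirichlet_mult u v)"

end

theory Submission
  imports Defs
begin

text \<open>
  Plot the coefficient of \<open>i\<^sup>-\<^sup>s\<close> at the point with abscissa \<open>ln i\<close> and ordinate its \<open>p\<close>-adic
  valuation. Multiplying Dirichlet polynomials adds the Newton polygons of such plots. For
  \<open>f + p\<^sup>k g\<close>, the points at \<open>m\<close> and \<open>n\<close> span an edge of slope \<open>k / ln (n / m)\<close> containing no other
  point. In a factorization this edge is the sum of parallel, possibly degenerate, edges of the two
  factors. If such an edge runs from \<open>u\<close> to \<open>u'\<close> and has height \<open>d\<close>, then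
  \<open>(u' / u)\<^sup>k = (n / m)\<^sup>d\<close>, so the gcd hypothesis forces \<open>k\<close> to divide \<open>d\<close>. The two heights add up to
  \<open>k\<close>, so one of them is 0. The corresponding edge is a single point \<open>u = u'\<close> dividing both
  \<open>m\<close> and \<open>n\<close>, thus \<open>u = 1\<close>; the other factor then has degree at least \<open>n\<close>, and this one is constant.
\<close>

subsection \<open>Valuations\<close>

lemma prime_elem_power_dvd_mult_cancel:
  fixes p a b :: "'a::idom"
  assumes "prime_elem p" and "\<not> p dvd a" and "p ^ e dvd a * b"
  shows "p ^ e dvd b"
  using assms(3)
proof (induction e arbitrary: b)
  case (Suc e)
  have "p dvd a * b"
    using Suc.prems dvd_trans[OF dvd_power[of "Suc e" p]] by simp
  then have "p dvd b" using prime_elem_dvd_multD[OF assms(1)] assms(2) by blast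
  then obtain c where b: "b = p * c" by (elim dvdE)
  have "p * p ^ e dvd p * (a * c)"
    using Suc.prems by (simp add: b algebra_simps)
  then have "p ^ e dvd a * c"
    using prime_elem_not_zeroI[OF assms(1)] by (subst (asm) dvd_mult_cancel_left) simp
  then have "p ^ e dvd c" by (rule Suc.IH)
  then show ?case by (simp add: b mult_dvd_mono)
qed simp

text \<open>For prime \<open>p\<close> and nonzero \<open>x\<close> in a UFD this is the
  \<open>p\<close>-adic valuation. At 0 no exponent qualifies and the value is unspecified, so
  \<open>newton_edge\<close> consults it only at nonzero coefficients.\<close>

definition pval :: "'a::idom \<Rightarrow> 'a \<Rightarrow> nat" where
  "pval p x = (LEAST e. \<not> p ^ Suc e dvd x)"

context
  fixes p :: "'a::ufd"
  assumes prime: "prime_elem p"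
begin

private lemma p_nonzero: "p \<noteq> 0" and p_nonunit: "\<not> p dvd 1"
  using prime unfolding prime_elem_def by auto

text \<open>An irreducible multiple \<open>p * c\<close> of \<open>p\<close> has a unit
  \<open>c\<close>, so each irreducible factor absorbs at most one \<open>p\<close>. This bound is
  what makes the valuation finite at nonzero elements.\<close>

lemma prime_power_dvd_prod_irreducibles:
  assumes "\<And>x. x \<in># F \<Longrightarrow> irreducible x" and "p ^ e dvd prod_mset F"
  shows "e \<le> size F"
  using assms
proof (induction F arbitrary: e)
  case empty
  then show ?case
    using p_nonunit by (cases e) (auto dest: dvd_mult_left)
next
  case (add f F)
  show ?case
  proof (cases e)
    case (Suc e')
    show ?thesis
    proof (cases "p dvd f")
      case True
      then obtain c where f: "f = p * c" by (elim dvdE)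
      have "irreducible f" using add.prems(1) by simp
      then have c: "c dvd 1"
        using irreducibleD[OF _ f] p_nonunit by blast
      have "p * p ^ e' dvd p * (c * prod_mset F)"
        using add.prems(2) by (simp add: f Suc algebra_simps)
      then have "p ^ e' dvd c * prod_mset F"
        using p_nonzero by (subst (asm) dvd_mult_cancel_left) simp
      moreover have "c * prod_mset F dvd prod_mset F"
        using mult_dvd_mono[OF c dvd_refl[of "prod_mset F"]] by simp
      ultimately have "p ^ e' dvd prod_mset F" by (rule dvd_trans)
      then have "e' \<le> size F" using add by simp
      then show ?thesis by (simp add: Suc)
    next
      case False
      have "p ^ e dvd prod_mset F"
        by (rule prime_elem_power_dvd_mult_cancel[OF prime False]) (use add.prems(2) in simp)
      then have "e \<le> size F" using add by simp
      then show ?thesis by simp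
    qed
  qed simp
qed

lemma ex_not_prime_power_dvd:
  assumes "x \<noteq> 0"
  shows "\<exists>e. \<not> p ^ Suc e dvd x"
proof (cases "x dvd 1")
  \<comment> \<open>Units are treated apart because \<open>mset_factors\<close> factors nonunits
    only.\<close>
  case True
  then have "\<not> p dvd x" using p_nonunit dvd_trans by blast
  then show ?thesis by (intro exI[of _ 0]) simp
next
  case False
  then obtain F where "mset_factors F x" using assms mset_factors_exist by blast
  then have "p ^ Suc (size F) dvd x \<Longrightarrow> Suc (size F) \<le> size F"
    using prime_power_dvd_prod_irreducibles[of F "Suc (size F)"] by (auto elim!: mset_factorsE)
  then show ?thesis by (intro exI[of _ "size F"]) auto
qed

lemma prime_power_dvd_iff_le_pval:
  assumes "x \<noteq> 0"
  shows "p ^ e dvd x \<longleftrightarrow> e \<le> pval p x"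
proof
  assume e: "p ^ e dvd x"
  have "\<not> p ^ Suc (pval p x) dvd x"
    unfolding pval_def by (rule LeastI_ex[OF ex_not_prime_power_dvd[OF assms]])
  then show "e \<le> pval p x"
    using e by (meson dvd_trans le_imp_power_dvd not_less_eq_eq)
next
  assume "e \<le> pval p x"
  show "p ^ e dvd x"
  proof (cases e)
    case (Suc e')
    then have "e' < pval p x" using \<open>e \<le> pval p x\<close> by simp
    then show ?thesis
      unfolding pval_def Suc using not_less_Least by blast
  qed simp
qed

lemma pval_eqI:
  assumes "\<not> p dvd y" and "x = p ^ e * y"
  shows "pval p x = e"
proof -
  have "y \<noteq> 0" using assms(1) by auto
  then have "x \<noteq> 0" using assms(2) p_nonzero by simp
  have "\<not> p ^ e * p dvd p ^ e * y"
    using assms(1) p_nonzero by (subst dvd_mult_cancel_left) simp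
  then have "\<not> p ^ Suc e dvd x" by (simp add: assms(2) mult.commute)
  moreover have "p ^ e dvd x" by (simp add: assms(2))
  ultimately have "e \<le> pval p x" "\<not> Suc e \<le> pval p x"
    using prime_power_dvd_iff_le_pval[OF \<open>x \<noteq> 0\<close>] by blast+
  then show ?thesis by simp
qed

lemma pval_decomp:
  assumes "x \<noteq> 0"
  obtains y where "x = p ^ pval p x * y" and "\<not> p dvd y"
proof -
  obtain y where y: "x = p ^ pval p x * y"
    using prime_power_dvd_iff_le_pval[OF assms, of "pval p x"] by (auto elim: dvdE)
  have "\<not> p dvd y"
  proof
    assume "p dvd y"
    then have "p ^ pval p x * p dvd x" by (subst (2) y) (rule mult_dvd_mono, simp_all)
    then have "p ^ Suc (pval p x) dvd x" by (simp add: mult.commute)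
    then show False using prime_power_dvd_iff_le_pval[OF assms] not_less_eq_eq by blast
  qed
  with y that show ?thesis by blast
qed

text \<open>The cofactors left after extracting the full powers of \<open>p\<close> are prime to
  \<open>p\<close>, and primality keeps their product so.\<close>

lemma pval_mult:
  assumes "x \<noteq> 0" and "y \<noteq> 0"
  shows "pval p (x * y) = pval p x + pval p y"
proof -
  obtain x' where x': "x = p ^ pval p x * x'" "\<not> p dvd x'" using pval_decomp assms(1) by blast
  obtain y' where y': "y = p ^ pval p y * y'" "\<not> p dvd y'" using pval_decomp assms(2) by blast
  show ?thesis
  proof (rule pval_eqI)
    show "\<not> p dvd x' * y'"
      using prime_elem_dvd_multD[OF prime] x'(2) y'(2) by blast
    show "x * y = p ^ (pval p x + pval p y) * (x' * y')"
      by (subst x'(1), subst y'(1)) (simp add: power_add algebra_simps)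
  qed
qed

end

subsection \<open>Dirichlet products\<close>

text \<open>This is the ultrametric inequality in terms of divisibility: with \<open>d\<close> a
  power of \<open>p\<close>, some summand has valuation no larger than that of the sum.\<close>

lemma not_dvd_sumE:
  fixes d :: "'a::comm_semiring_1"
  assumes "\<not> d dvd sum t A"
  obtains x where "x \<in> A" and "\<not> d dvd t x"
proof (rule ccontr)
  assume "\<not> thesis"
  with that have "\<forall>x\<in>A. d dvd t x" by blast
  then have "d dvd sum t A" by (intro dvd_sum) blast
  with assms show False ..
qed

lemma finite_factor_pairs: "finite {(j, k). 0 < j \<and> 0 < k \<and> j * k = (i::nat)}"
proof (rule finite_subset)
  show "{(j, k). 0 < j \<and> 0 < k \<and> j * k = i} \<subseteq> {..i} \<times> {..i}" by auto
qed simp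

lemma dirichlet_poly_index_pos: "dirichlet_poly a \<Longrightarrow> a i \<noteq> 0 \<Longrightarrow> 0 < i"
  by (cases i) (auto simp: dirichlet_poly_def)

lemma nonzero_le_degree:
  "dirichlet_poly a \<Longrightarrow> a i \<noteq> 0 \<Longrightarrow> i \<le> dirichlet_degree a"
  by (simp add: dirichlet_poly_def dirichlet_degree_def)

lemma degree_nonzero:
  assumes "dirichlet_poly a" and "a \<noteq> (\<lambda>_. 0)"
  shows "a (dirichlet_degree a) \<noteq> 0"
proof -
  have "Max {i. a i \<noteq> 0} \<in> {i. a i \<noteq> 0}"
    using assms by (intro Max_in) (auto simp: dirichlet_poly_def)
  then show ?thesis by (simp add: dirichlet_degree_def)
qed

lemma dirichlet_mult_split:
  fixes j k :: nat
  assumes "0 < j" and "0 < k"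
  shows "dirichlet_mult a b (j * k) = a j * b k +
    (\<Sum>(j', k')\<in>{(j', k'). 0 < j' \<and> 0 < k' \<and> j' * k' = j * k} - {(j, k)}. a j' * b k')"
  unfolding dirichlet_mult_def
  using assms by (subst sum.remove[OF finite_factor_pairs, of "(j, k)"]) auto

text \<open>Equality of the products leaves no slack in either bound. Hence a corner of a box of
  index pairs is the only pair of the box with its product.\<close>

lemma mult_eq_imp_eq_of_le:
  fixes i j k l :: nat
  assumes "i \<le> j" and "k \<le> l" and "i * k = j * l" and "0 < j" and "0 < l"
  shows "i = j \<and> k = l"
proof -
  have "j * k \<le> j * l" using assms by simp
  moreover have "j * l \<le> j * k" unfolding assms(3)[symmetric] using assms(1) by simp
  ultimately have "j * k = j * l" by (rule order.antisym)
  then have "k = l" using assms(4) by simp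
  then show ?thesis using assms by simp
qed

text \<open>Only the pair of degrees contributes to this coefficient, and its contribution is
  nonzero in a domain.\<close>

lemma dirichlet_mult_degrees:
  fixes a b :: "nat \<Rightarrow> 'a::idom"
  assumes "dirichlet_poly a" and "a \<noteq> (\<lambda>_. 0)" and "dirichlet_poly b" and "b \<noteq> (\<lambda>_. 0)"
  shows "dirichlet_mult a b (dirichlet_degree a * dirichlet_degree b) \<noteq> 0"
proof -
  let ?j = "dirichlet_degree a" and ?k = "dirichlet_degree b"
  have nz: "a ?j \<noteq> 0" "b ?k \<noteq> 0" using assms degree_nonzero by auto
  then have pos: "0 < ?j" "0 < ?k" using assms dirichlet_poly_index_pos by auto
  have zero: "a j * b k = 0" if "j * k = ?j * ?k" "(j, k) \<noteq> (?j, ?k)" for j k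
  proof (rule ccontr)
    assume "a j * b k \<noteq> 0"
    then have "j \<le> ?j" "k \<le> ?k" using nonzero_le_degree assms by auto
    then show False using mult_eq_imp_eq_of_le[of j ?j k ?k] pos that by simp
  qed
  have "dirichlet_mult a b (?j * ?k) = a ?j * b ?k + 0"
    unfolding dirichlet_mult_split[OF pos]
  proof (intro arg_cong2[of _ _ _ _ plus] refl sum.neutral ballI)
    fix x
    assume "x \<in> {(j, k). 0 < j \<and> 0 < k \<and> j * k = ?j * ?k} - {(?j, ?k)}"
    moreover obtain j k where "x = (j, k)" by (cases x)
    ultimately show "(case x of (j, k) \<Rightarrow> a j * b k) = 0" using zero[of j k] by simp
  qed
  with nz show ?thesis by simp
qed

text \<open>Valuations are taken in the ring itself, so a factor over the quotient field must be
  scaled into the ring before its plot can be considered.\<close>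

lemma clear_denominators:
  fixes u :: "nat \<Rightarrow> 'a::idom fract"
  assumes "finite {i. u i \<noteq> 0}"
  obtains d U where "d \<noteq> 0" and "\<And>i. to_fract (U i) = to_fract d * u i"
proof -
  have "\<exists>d. d \<noteq> 0 \<and> (\<forall>i\<in>I. \<exists>x. to_fract x = to_fract d * u i)" if "finite I" for I
    using that
  proof induction
    case empty
    show ?case by (rule exI[of _ 1]) simp
  next
    case (insert i I)
    then obtain d where d: "d \<noteq> 0" "\<forall>i\<in>I. \<exists>x. to_fract x = to_fract d * u i" by blast
    obtain x y where xy: "u i = Fract x y" "y \<noteq> 0" by (cases "u i") auto
    have "\<exists>z. to_fract z = to_fract (y * d) * u i'" if "i' \<in> insert i I" for i'
    proof (cases "i' = i")
      case True
      have "to_fract (d * x) = to_fract (y * d) * u i'"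
        using xy True by (simp add: Fract_conv_to_fract)
      then show ?thesis ..
    next
      case False
      with that d(2) obtain z where "to_fract z = to_fract d * u i'" by blast
      then have "to_fract (y * z) = to_fract (y * d) * u i'" by (simp add: algebra_simps)
      then show ?thesis ..
    qed
    then show ?case using d(1) xy(2) by (intro exI[of _ "y * d"]) auto
  qed
  from this[OF assms] obtain d where d: "d \<noteq> 0"
    and ex: "\<forall>i\<in>{i. u i \<noteq> 0}. \<exists>x. to_fract x = to_fract d * u i" by blast
  have "\<exists>x. to_fract x = to_fract d * u i" for i
    using ex by (cases "u i = 0") (auto intro: exI[of _ 0])
  then obtain U where "\<And>i. to_fract (U i) = to_fract d * u i" by metis
  with d that show ?thesis by blast
qed

subsection \<open>Newton polygon edges\<close>

text \<open>Intercept on the vertical axis of the line of slope \<open>\<sigma>\<close> through the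
  plotted point of index \<open>i\<close>. Valuation and logarithm both turn products into sums,
  which makes intercepts additive.\<close>

definition weight :: "'a::idom \<Rightarrow> real \<Rightarrow> (nat \<Rightarrow> 'a) \<Rightarrow> nat \<Rightarrow> real" where
  "weight p \<sigma> a i = real (pval p (a i)) - \<sigma> * ln (real i)"

text \<open>
  The points on the supporting line of slope \<open>\<sigma>\<close> have smallest index \<open>i\<close> and largest index \<open>j\<close>;
  \<open>\<mu>\<close> is the height at which the line meets the vertical axis.
\<close>

definition newton_edge ::
    "'a::idom \<Rightarrow> real \<Rightarrow> (nat \<Rightarrow> 'a) \<Rightarrow> real \<Rightarrow> nat \<Rightarrow> nat \<Rightarrow> bool" where
  "newton_edge p \<sigma> a \<mu> i j \<longleftrightarrow>
     a i \<noteq> 0 \<and> a j \<noteq> 0 \<and> weight p \<sigma> a i = \<mu> \<and> weight p \<sigma> a j = \<mu> \<and>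
     (\<forall>l. a l \<noteq> 0 \<longrightarrow> \<mu> \<le> weight p \<sigma> a l) \<and>
     (\<forall>l. a l \<noteq> 0 \<longrightarrow> weight p \<sigma> a l = \<mu> \<longrightarrow> i \<le> l \<and> l \<le> j)"

text \<open>For any slope, the supporting line has the least intercept over the finite support. The
  edge may be the single point \<open>i = j\<close>.\<close>

lemma newton_edge_exists:
  assumes "dirichlet_poly a" and "a \<noteq> (\<lambda>_. 0)"
  obtains \<mu> i j where "newton_edge p \<sigma> a \<mu> i j"
proof -
  let ?S = "{l. a l \<noteq> 0}"
  define \<mu> where "\<mu> = Min (weight p \<sigma> a ` ?S)"
  define T where "T = {l. a l \<noteq> 0 \<and> weight p \<sigma> a l = \<mu>}"
  have fin: "finite ?S" using assms(1) by (simp add: dirichlet_poly_def)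
  have "?S \<noteq> {}" using assms(2) by auto
  then have "\<mu> \<in> weight p \<sigma> a ` ?S" unfolding \<mu>_def using fin by (intro Min_in) auto
  then have T: "T \<noteq> {}" "finite T" using fin by (auto simp: T_def)
  then have "Min T \<in> T" "Max T \<in> T" by auto
  moreover have "\<mu> \<le> weight p \<sigma> a l" if "a l \<noteq> 0" for l
    unfolding \<mu>_def using fin that by (intro Min_le) auto
  moreover have "Min T \<le> l \<and> l \<le> Max T" if "a l \<noteq> 0" "weight p \<sigma> a l = \<mu>" for l
    using T that by (simp add: T_def)
  ultimately have "newton_edge p \<sigma> a \<mu> (Min T) (Max T)"
    unfolding newton_edge_def by (simp add: T_def)
  then show ?thesis by (rule that)
qed

lemma newton_edge_unique:
  assumes "newton_edge p \<sigma> a \<mu> i j" and "newton_edge p \<sigma> a \<mu>' i' j'"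
  shows "i = i'" and "j = j'"
proof -
  have "\<mu> = \<mu>'" using assms unfolding newton_edge_def by (metis order_antisym)
  then show "i = i'" "j = j'" using assms unfolding newton_edge_def by (metis order_antisym)+
qed

section \<open>Edges of scalar multiples and of products\<close>

context
  fixes p :: "'a::ufd"
  assumes prime: "prime_elem p"
begin

text \<open>A constant factor shifts all ordinates equally, so cleared denominators do not move the
  endpoints.\<close>

lemma newton_edge_scale:
  assumes "newton_edge p \<sigma> a \<mu> i j" and "c \<noteq> 0"
  shows "newton_edge p \<sigma> (\<lambda>l. c * a l) (\<mu> + real (pval p c)) i j"
proof -
  have w: "weight p \<sigma> (\<lambda>l. c * a l) l = weight p \<sigma> a l + real (pval p c)" if "a l \<noteq> 0" for l
    using pval_mult[OF prime assms(2) that] by (simp add: weight_def)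
  show ?thesis
    using assms(1) unfolding newton_edge_def by (simp add: w assms(2))
qed

text \<open>Some summand has valuation at most that of the whole coefficient. All summands share the
  abscissa \<open>ln i\<close>, so the comparison carries over to weights.\<close>

lemma dirichlet_mult_weight:
  assumes "dirichlet_mult a b i \<noteq> 0"
  obtains j k where "j * k = i" and "a j \<noteq> 0" and "b k \<noteq> 0"
    and "weight p \<sigma> a j + weight p \<sigma> b k \<le> weight p \<sigma> (dirichlet_mult a b) i"
proof -
  define v where "v = pval p (dirichlet_mult a b i)"
  have "\<not> p ^ Suc v dvd dirichlet_mult a b i"
    using prime_power_dvd_iff_le_pval[OF prime assms, of "Suc v"] by (simp only: v_def not_less_eq_eq)
  then obtain x where x: "x \<in> {(j, k). 0 < j \<and> 0 < k \<and> j * k = i}"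
    and "\<not> p ^ Suc v dvd (case x of (j, k) \<Rightarrow> a j * b k)"
    unfolding dirichlet_mult_def by (rule not_dvd_sumE)
  moreover obtain j k where "x = (j, k)" by (cases x)
  ultimately have jk: "0 < j" "0 < k" "j * k = i" and nd: "\<not> p ^ Suc v dvd a j * b k"
    by (simp_all only: mem_Collect_eq case_prod_conv simp_thms)
  have "a j * b k \<noteq> 0" using nd by (metis dvd_0_right)
  then have nz: "a j \<noteq> 0" "b k \<noteq> 0" by auto
  then have "pval p (a j) + pval p (b k) \<le> v"
    using nd by (simp only: prime_power_dvd_iff_le_pval[OF prime \<open>a j * b k \<noteq> 0\<close>]
        pval_mult[OF prime nz] not_less_eq_eq)
  moreover have "ln (real i) = ln (real j) + ln (real k)"
    using jk by (auto simp: ln_mult)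
  ultimately have "weight p \<sigma> a j + weight p \<sigma> b k \<le> weight p \<sigma> (dirichlet_mult a b) i"
    by (simp add: weight_def v_def distrib_left)
  with jk nz that show ?thesis by blast
qed

text \<open>Every other summand is divisible by one more power of \<open>p\<close> than
  \<open>a j * b k\<close>, so it cannot cancel the latter's lowest power of
  \<open>p\<close>.\<close>

lemma weight_isolated_product:
  assumes pos: "0 < j" "0 < k" and nz: "a j \<noteq> 0" "b k \<noteq> 0"
    and dom: "\<And>j' k'. j' * k' = j * k \<Longrightarrow> (j', k') \<noteq> (j, k) \<Longrightarrow> a j' \<noteq> 0 \<Longrightarrow> b k' \<noteq> 0 \<Longrightarrow>
      weight p \<sigma> a j + weight p \<sigma> b k < weight p \<sigma> a j' + weight p \<sigma> b k'"
  shows "dirichlet_mult a b (j * k) \<noteq> 0" and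
    "weight p \<sigma> (dirichlet_mult a b) (j * k) = weight p \<sigma> a j + weight p \<sigma> b k"
proof -
  let ?v = "pval p (a j) + pval p (b k)"
  obtain y where y: "a j * b k = p ^ ?v * y" "\<not> p dvd y"
    using pval_decomp[OF prime, of "a j * b k"] pval_mult[OF prime nz] nz by auto
  have "p ^ Suc ?v dvd a j' * b k'"
    if jk: "0 < j'" "0 < k'" "j' * k' = j * k" "(j', k') \<noteq> (j, k)" for j' k'
  proof (cases "a j' * b k' = 0")
    case False
    then have nz': "a j' \<noteq> 0" "b k' \<noteq> 0" by auto
    have "ln (real j') + ln (real k') = ln (real (j' * k'))"
      using jk(1,2) by (simp add: ln_mult)
    also have "\<dots> = ln (real j) + ln (real k)"
      unfolding jk(3) using pos by (simp add: ln_mult)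
    \<comment> \<open>The logarithmic terms agree, so strict dominance of weights is strict
      dominance of valuations; these are integers, hence a gap of at least 1.\<close>
    finally have "\<sigma> * ln (real j') + \<sigma> * ln (real k') = \<sigma> * ln (real j) + \<sigma> * ln (real k)"
      by (simp flip: distrib_left)
    then have "real ?v < real (pval p (a j') + pval p (b k'))"
      using dom[OF jk(3,4) nz'] by (simp add: weight_def)
    then have "Suc ?v \<le> pval p (a j' * b k')" by (simp add: pval_mult[OF prime nz'])
    then show ?thesis using prime_power_dvd_iff_le_pval[OF prime False] by blast
  qed (simp only: dvd_0_right)
  then have rest: "p ^ Suc ?v dvd (case x of (j', k') \<Rightarrow> a j' * b k')"
    if "x \<in> {(j', k'). 0 < j' \<and> 0 < k' \<and> j' * k' = j * k} - {(j, k)}" for x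
    using that by (cases x) (simp del: power_Suc)
  have "p ^ Suc ?v dvd
      (\<Sum>(j', k')\<in>{(j', k'). 0 < j' \<and> 0 < k' \<and> j' * k' = j * k} - {(j, k)}. a j' * b k')"
    (is "_ dvd ?s")
    by (rule dvd_sum) (rule rest)
  then obtain z where z: "?s = p ^ Suc ?v * z" by (elim dvdE)
  have eq: "dirichlet_mult a b (j * k) = p ^ ?v * (y + p * z)"
    unfolding dirichlet_mult_split[OF pos] y(1) z by (simp add: algebra_simps)
  have nd: "\<not> p dvd y + p * z" using y(2) by (simp add: dvd_add_left_iff)
  then have "y + p * z \<noteq> 0" by (metis dvd_0_right)
  then show "dirichlet_mult a b (j * k) \<noteq> 0" using eq prime_elem_not_zeroI[OF prime] by simp
  have "pval p (dirichlet_mult a b (j * k)) = ?v" using pval_eqI[OF prime nd eq] .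
  then show "weight p \<sigma> (dirichlet_mult a b) (j * k) = weight p \<sigma> a j + weight p \<sigma> b k"
    using pos by (simp add: weight_def ln_mult algebra_simps)
qed

text \<open>The counterpart, for one slope, of Dumas's theorem on Newton polygons of products. Pairs
  of minimal total weight lie in the box spanned by the two edges, and each of its two extreme
  corners is alone in its coefficient, so nothing cancels there.\<close>

lemma newton_edge_mult:
  assumes a: "dirichlet_poly a" "newton_edge p \<sigma> a \<mu> i j"
    and b: "dirichlet_poly b" "newton_edge p \<sigma> b \<nu> i' j'"
  shows "newton_edge p \<sigma> (dirichlet_mult a b) (\<mu> + \<nu>) (i * i') (j * j')"
proof -
  note e = a(2)[unfolded newton_edge_def] b(2)[unfolded newton_edge_def]
  have pos: "0 < i" "0 < i'" "0 < j" "0 < j'"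
    using e a(1) b(1) dirichlet_poly_index_pos by blast+
  have dom: "\<mu> + \<nu> < weight p \<sigma> a l + weight p \<sigma> b l'"
    if "a l \<noteq> 0" "b l' \<noteq> 0" "\<not> (i \<le> l \<and> l \<le> j \<and> i' \<le> l' \<and> l' \<le> j')" for l l'
  proof -
    have "\<mu> \<le> weight p \<sigma> a l" "\<nu> \<le> weight p \<sigma> b l'" using e that by auto
    moreover have "\<mu> \<noteq> weight p \<sigma> a l \<or> \<nu> \<noteq> weight p \<sigma> b l'" using e that by metis
    ultimately show ?thesis by linarith
  qed
  have lo: "\<not> (i \<le> l \<and> l \<le> j \<and> i' \<le> l' \<and> l' \<le> j')"
    if "l * l' = i * i'" "(l, l') \<noteq> (i, i')" for l l'
    using mult_eq_imp_eq_of_le[of i l i' l'] that pos by auto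
  have hi: "\<not> (i \<le> l \<and> l \<le> j \<and> i' \<le> l' \<and> l' \<le> j')"
    if "l * l' = j * j'" "(l, l') \<noteq> (j, j')" for l l'
    using mult_eq_imp_eq_of_le[of l j l' j'] that pos by auto
  have w: "weight p \<sigma> a i = \<mu>" "weight p \<sigma> a j = \<mu>" "weight p \<sigma> b i' = \<nu>" "weight p \<sigma> b j' = \<nu>"
    and nz: "a i \<noteq> 0" "a j \<noteq> 0" "b i' \<noteq> 0" "b j' \<noteq> 0" using e by auto
  note first = weight_isolated_product[of i i' a b \<sigma>, OF pos(1,2) nz(1,3),
      unfolded w, OF dom[OF _ _ lo]]
  note last = weight_isolated_product[of j j' a b \<sigma>, OF pos(3,4) nz(2,4),
      unfolded w, OF dom[OF _ _ hi]]
  have "\<mu> + \<nu> \<le> weight p \<sigma> (dirichlet_mult a b) l \<and>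
      (weight p \<sigma> (dirichlet_mult a b) l = \<mu> + \<nu> \<longrightarrow> i * i' \<le> l \<and> l \<le> j * j')"
    if "dirichlet_mult a b l \<noteq> 0" for l
  proof -
    obtain x y where xy: "x * y = l" "a x \<noteq> 0" "b y \<noteq> 0"
      and le: "weight p \<sigma> a x + weight p \<sigma> b y \<le> weight p \<sigma> (dirichlet_mult a b) l"
      using dirichlet_mult_weight[OF \<open>dirichlet_mult a b l \<noteq> 0\<close>] by blast
    have "\<mu> \<le> weight p \<sigma> a x" "\<nu> \<le> weight p \<sigma> b y" using e xy by auto
    moreover have "i * i' \<le> l \<and> l \<le> j * j'" if "weight p \<sigma> (dirichlet_mult a b) l = \<mu> + \<nu>"
    proof -
      have "i \<le> x \<and> x \<le> j \<and> i' \<le> y \<and> y \<le> j'"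
        using dom[OF xy(2,3)] le that by linarith
      then show ?thesis unfolding xy(1)[symmetric] by (simp add: mult_le_mono)
    qed
    ultimately show ?thesis using le by linarith
  qed
  with first last show ?thesis unfolding newton_edge_def by auto
qed

end

subsection \<open>Arithmetic of the edge\<close>

text \<open>Comparing exponents of a prime \<open>q\<close> gives
  \<open>d * s = k * (multiplicity q u' - multiplicity q u)\<close> with \<open>s\<close> the
  exponent difference of \<open>n\<close> and \<open>m\<close>. So \<open>k\<close> divides
  \<open>d\<close> times each member of a set with gcd 1.\<close>

lemma dvd_height_of_power_relation:
  fixes m n k d u u' :: nat
  assumes pos: "0 < m" "0 < n" "0 < u" "0 < u'"
    and rel: "n ^ d * u ^ k = m ^ d * u' ^ k"
    and gcd: "Gcd (insert (int k)
      ((\<lambda>q. int (multiplicity q n) - int (multiplicity q m)) ` prime_factors (m * n))) = 1"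
      (is "Gcd ?S = 1")
  shows "k dvd d"
proof -
  have "int k dvd int d * s" if "s \<in> ?S" for s
  proof (cases "s = int k")
    case False
    then obtain q where q: "q \<in> prime_factors (m * n)"
      and s: "s = int (multiplicity q n) - int (multiplicity q m)" using \<open>s \<in> ?S\<close> by auto
    have pq: "prime_elem q" using q by auto
    have "d * multiplicity q n + k * multiplicity q u = d * multiplicity q m + k * multiplicity q u'"
      using arg_cong[OF rel, of "multiplicity q"] pos pq
      by (simp add: prime_elem_multiplicity_mult_distrib prime_elem_multiplicity_power_distrib)
    then have "int d * int (multiplicity q n) + int k * int (multiplicity q u)
        = int d * int (multiplicity q m) + int k * int (multiplicity q u')"
      by (metis of_nat_add of_nat_mult)
    then have "int d * s = int k * (int (multiplicity q u') - int (multiplicity q u))"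
      unfolding s by (simp add: algebra_simps)
    then show ?thesis by simp
  qed simp
  then have "int k dvd Gcd ((*) (int d) ` ?S)" by (intro Gcd_greatest) auto
  also have "Gcd ((*) (int d) ` ?S) = int d" by (simp only: Gcd_mult gcd) simp
  finally show ?thesis by simp
qed

lemma edge_height:
  fixes m n k :: nat
  assumes mn: "0 < m" "m < n" and "0 < k"
    and "dirichlet_poly a" and edge: "newton_edge p (real k / (ln n - ln m)) a \<mu> i j"
    and gcd: "Gcd (insert (int k)
      ((\<lambda>q. int (multiplicity q n) - int (multiplicity q m)) ` prime_factors (m * n))) = 1"
  obtains d where "pval p (a j) = pval p (a i) + d" and "k dvd d"
    and "real d * (ln n - ln m) = real k * (ln j - ln i)"
proof -
  let ?L = "ln (real n) - ln (real m)"
  have L: "0 < ?L" using mn by simp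
  have e: "a i \<noteq> 0" "a j \<noteq> 0" "i \<le> j"
    and w: "real (pval p (a j)) - real k / ?L * ln j = real (pval p (a i)) - real k / ?L * ln i"
    using edge by (auto simp: newton_edge_def weight_def)
  have pos: "0 < i" "0 < j" using e assms(4) dirichlet_poly_index_pos by auto
  have diff: "real (pval p (a j)) - real (pval p (a i)) = real k / ?L * (ln j - ln i)"
    using w by (simp add: right_diff_distrib)
  \<comment> \<open>The slope is positive and \<open>i \<le> j\<close>, so the height of the edge is
    a natural number.\<close>
  also have "\<dots> \<ge> 0" using L e(3) pos by simp
  finally have "pval p (a i) \<le> pval p (a j)" by simp
  then obtain d where d: "pval p (a j) = pval p (a i) + d" using le_Suc_ex by blast
  then have dL: "real d * ?L = real k * (ln j - ln i)"
    using diff L by (simp add: field_simps)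
  \<comment> \<open>Exponentiating the slope equation yields a relation between integers, to which
    unique factorization applies.\<close>
  then have "ln (real (n ^ d * i ^ k)) = ln (real (m ^ d * j ^ k))"
    using mn pos by (simp add: ln_mult ln_realpow algebra_simps)
  then have "real (n ^ d * i ^ k) = real (m ^ d * j ^ k)"
    using mn pos by (subst (asm) ln_inj_iff) auto
  then have "n ^ d * i ^ k = m ^ d * j ^ k" by (simp only: of_nat_eq_iff)
  then have "k dvd d" using dvd_height_of_power_relation[OF _ _ _ _ _ gcd] mn pos by auto
  with d dL that show ?thesis by blast
qed

text \<open>Degrees multiply, so a cofactor of degree at least \<open>n\<close> leaves degree at
  most 1 for \<open>a\<close>, and index 0 is excluded.\<close>

lemma dirichlet_constant_if_cofactor_full_degree:
  fixes a b :: "nat \<Rightarrow> 'a::idom"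
  assumes a: "dirichlet_poly a" "a \<noteq> (\<lambda>_. 0)"
    and b: "dirichlet_poly b" "b (n::nat) \<noteq> 0" and "0 < n"
    and top: "\<And>i. dirichlet_mult a b i \<noteq> 0 \<Longrightarrow> i \<le> n"
  shows "dirichlet_constant a"
proof -
  have "b \<noteq> (\<lambda>_. 0)" using b(2) by auto
  then have "dirichlet_degree a * dirichlet_degree b \<le> n"
    using top dirichlet_mult_degrees a b(1) by blast
  moreover have "dirichlet_degree a * n \<le> dirichlet_degree a * dirichlet_degree b"
    using nonzero_le_degree[OF b] by simp
  ultimately have "dirichlet_degree a * n \<le> 1 * n" by linarith
  then have deg: "dirichlet_degree a \<le> 1" using \<open>0 < n\<close> by (simp only: mult_le_cancel2)
  have "i = 1" if "a i \<noteq> 0" for i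
    using dirichlet_poly_index_pos[OF a(1) that] nonzero_le_degree[OF a(1) that] deg by simp
  then show ?thesis by (auto simp: dirichlet_constant_def)
qed

lemma dirichlet_mult_commute: "dirichlet_mult a b = dirichlet_mult b a"
proof
  fix i
  show "dirichlet_mult a b i = dirichlet_mult b a i"
    unfolding dirichlet_mult_def
    by (rule sum.reindex_bij_witness[of _ prod.swap prod.swap]) (auto simp: mult.commute)
qed

text \<open>The line passes through height 0 at \<open>m\<close> and height \<open>k\<close> at
  \<open>n\<close>. Left of \<open>m\<close> it is below 0, while valuations are not. Strictly
  between \<open>m\<close> and \<open>n\<close> it is below \<open>k\<close>, while only
  \<open>p ^ k * g\<close> contributes.\<close>

lemma newton_edge_sum_prime_power:
  fixes p :: "'a::ufd"
  assumes p: "prime_elem p" and "0 < k"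
    and f: "dirichlet_poly f" "dirichlet_degree f = m" "\<not> p dvd f m"
    and g: "dirichlet_poly g" "dirichlet_degree g = n" "\<not> p dvd g n"
    and "m < n"
  shows "newton_edge p (real k / (ln n - ln m)) (\<lambda>i. f i + p ^ k * g i)
    (- (real k / (ln n - ln m) * ln m)) m n"
proof -
  define h where "h = (\<lambda>i. f i + p ^ k * g i)"
  define L where "L = ln (real n) - ln (real m)"
  have f0: "f i = 0" if "m < i" for i
    using nonzero_le_degree[OF f(1)] f(2) that by fastforce
  have g0: "g i = 0" if "n < i" for i
    using nonzero_le_degree[OF g(1)] g(2) that by fastforce
  have "f m \<noteq> 0" using f(3) by auto
  then have "0 < m" using f(1) dirichlet_poly_index_pos by blast
  then have L: "0 < L" using \<open>m < n\<close> by (simp add: L_def)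
  \<comment> \<open>Positivity of \<open>k\<close> matters here: the second summand must not disturb
    the valuation 0 at \<open>m\<close>.\<close>
  have "p dvd p ^ k * g m" using \<open>0 < k\<close> by (simp add: dvd_power)
  then have ndm: "\<not> p dvd h m" using f(3) by (simp add: h_def dvd_add_left_iff)
  then have vm: "pval p (h m) = 0" by (intro pval_eqI[OF p]) auto
  have hn: "h n = p ^ k * g n" using f0 \<open>m < n\<close> by (simp add: h_def)
  have vn: "pval p (h n) = k" by (rule pval_eqI[OF p g(3) hn])
  have nz: "h m \<noteq> 0" "h n \<noteq> 0" using ndm hn g(3) p by (auto simp: prime_elem_def)
  have kL: "real k / L * ln n = real k + real k / L * ln m"
    using L by (simp add: L_def field_simps)
  have strict: "- (real k / L * ln m) < weight p (real k / L) h i"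
    if hi: "h i \<noteq> 0" and "i \<noteq> m" "i \<noteq> n" for i
  proof -
    have "0 < i" using hi f(1) g(1) by (cases i) (auto simp: h_def dirichlet_poly_def)
    have "i \<le> n"
    proof (rule ccontr)
      assume "\<not> i \<le> n"
      then have "f i = 0" "g i = 0" using f0 g0 \<open>m < n\<close> by auto
      with hi show False by (simp add: h_def)
    qed
    show ?thesis
    proof (cases "i < m")
      case True
      then have "real k / L * ln i < real k / L * ln m"
        using L \<open>0 < k\<close> \<open>0 < i\<close> by (intro mult_strict_left_mono) auto
      then show ?thesis by (simp add: weight_def)
    next
      case False
      then have "p ^ k dvd h i" using f0[of i] that by (simp add: h_def)
      then have "k \<le> pval p (h i)" using prime_power_dvd_iff_le_pval[OF p hi] by blast
      moreover have "real k / L * ln i < real k / L * ln n"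
        using L \<open>0 < k\<close> \<open>0 < i\<close> \<open>i \<le> n\<close> \<open>i \<noteq> n\<close> by (intro mult_strict_left_mono) auto
      ultimately show ?thesis using kL by (simp add: weight_def)
    qed
  qed
  have w: "weight p (real k / L) h m = - (real k / L * ln m)"
    "weight p (real k / L) h n = - (real k / L * ln m)"
    using kL by (simp_all add: weight_def vm vn)
  have "newton_edge p (real k / L) h (- (real k / L * ln m)) m n"
    unfolding newton_edge_def
    using nz w strict \<open>m < n\<close> by (metis less_imp_le order.refl order_less_irrefl)
  then show ?thesis by (simp add: h_def L_def)
qed

section \<open>Factorizations over the quotient field\<close>

theorem theorem3p12:
  fixes f g :: "nat \<Rightarrow> 'a::ufd" and p :: 'a and m n k :: nat
  assumes "dirichlet_poly f" and "f \<noteq> (\<lambda>_. 0)" and "dirichlet_degree f = m"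
    and "dirichlet_poly g" and "g \<noteq> (\<lambda>_. 0)" and "dirichlet_degree g = n"
    and "Rings.coprime m n" and "m < n"
    and "prime_elem p"
    and "\<not> p dvd dirichlet_lead_coeff f" and "\<not> p dvd dirichlet_lead_coeff g"
    and "k > 0"
    and "Gcd (insert (int k)
           ((\<lambda>q. int (multiplicity q n) - int (multiplicity q m)) ` prime_factors (m * n))) = 1"
  shows "dirichlet_irreducible (\<lambda>i. to_fract (f i + p ^ k * g i))"
  unfolding dirichlet_irreducible_def
proof safe
  fix u v :: "nat \<Rightarrow> 'a fract"
  assume u: "dirichlet_poly u" "\<not> dirichlet_constant u"
    and v: "dirichlet_poly v" "\<not> dirichlet_constant v"
    and uv: "(\<lambda>i. to_fract (f i + p ^ k * g i)) = dirichlet_mult u v"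
  define h where "h = (\<lambda>i. f i + p ^ k * g i)"
  define \<sigma> where "\<sigma> = real k / (ln n - ln m)"
  have lead: "\<not> p dvd f m" "\<not> p dvd g n"
    using assms by (auto simp: dirichlet_lead_coeff_def)
  then have "0 < m" using dirichlet_poly_index_pos[OF assms(1)] by (metis dvd_0_right)
  have hedge: "newton_edge p \<sigma> h (- (\<sigma> * ln m)) m n"
    unfolding h_def \<sigma>_def by (intro newton_edge_sum_prime_power) (use assms lead in auto)
  obtain c U where c: "c \<noteq> 0" and U: "\<And>i. to_fract (U i) = to_fract c * u i"
    using clear_denominators[of u] u(1) by (auto simp: dirichlet_poly_def)
  obtain d V where d: "d \<noteq> 0" and V: "\<And>i. to_fract (V i) = to_fract d * v i"
    using clear_denominators[of v] v(1) by (auto simp: dirichlet_poly_def)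
  have U0: "U i = 0 \<longleftrightarrow> u i = 0" for i
    using U[of i] c by (metis mult_eq_0_iff to_fract_eq_0_iff)
  have V0: "V i = 0 \<longleftrightarrow> v i = 0" for i
    using V[of i] d by (metis mult_eq_0_iff to_fract_eq_0_iff)
  have U': "dirichlet_poly U" "\<not> dirichlet_constant U"
    using u by (simp_all add: dirichlet_poly_def dirichlet_constant_def U0)
  have V': "dirichlet_poly V" "\<not> dirichlet_constant V"
    using v by (simp_all add: dirichlet_poly_def dirichlet_constant_def V0)
  have Unz: "U \<noteq> (\<lambda>_. 0)" and Vnz: "V \<noteq> (\<lambda>_. 0)"
    using U'(2) V'(2) by (auto simp: dirichlet_constant_def)
  have UV: "dirichlet_mult U V = (\<lambda>i. (c * d) * h i)"
  proof
    fix i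
    have "to_fract (dirichlet_mult U V i) = to_fract (c * d) * dirichlet_mult u v i"
      unfolding dirichlet_mult_def sum_distrib_left to_fract_sum
      by (intro sum.cong) (auto simp: U V)
    also have "\<dots> = to_fract ((c * d) * h i)"
      using fun_cong[OF uv, of i] by (simp add: h_def)
    finally show "dirichlet_mult U V i = (c * d) * h i" by (simp only: to_fract_eq_iff)
  qed
  obtain \<mu> i j where e: "newton_edge p \<sigma> U \<mu> i j"
    using newton_edge_exists[OF U'(1) Unz] by blast
  obtain \<nu> i' j' where e': "newton_edge p \<sigma> V \<nu> i' j'"
    using newton_edge_exists[OF V'(1) Vnz] by blast
  \<comment> \<open>The same edge is described twice, through the factors and through
    \<open>h\<close>; uniqueness then factors \<open>m\<close> and \<open>n\<close> along the
    endpoints.\<close>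
  have "newton_edge p \<sigma> (\<lambda>i. (c * d) * h i) (\<mu> + \<nu>) (i * i') (j * j')"
    using newton_edge_mult[OF assms(9) U'(1) e V'(1) e'] by (simp add: UV)
  moreover have "newton_edge p \<sigma> (\<lambda>i. (c * d) * h i) (- (\<sigma> * ln m) + real (pval p (c * d))) m n"
    using newton_edge_scale[OF assms(9) hedge] c d by simp
  ultimately have mn: "m = i * i'" "n = j * j'" using newton_edge_unique by blast+
  have "0 < i * i'" "0 < j * j'" using \<open>0 < m\<close> \<open>m < n\<close> by (auto simp flip: mn)
  then have pos: "0 < i" "0 < i'" "0 < j" "0 < j'" by auto
  obtain x where x: "k dvd x" "real x * (ln n - ln m) = real k * (ln j - ln i)"
    using edge_height[OF \<open>0 < m\<close> \<open>m < n\<close> \<open>k > 0\<close> U'(1) e[unfolded \<sigma>_def] assms(13)] by blast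
  obtain y where y: "k dvd y" "real y * (ln n - ln m) = real k * (ln j' - ln i')"
    using edge_height[OF \<open>0 < m\<close> \<open>m < n\<close> \<open>k > 0\<close> V'(1) e'[unfolded \<sigma>_def] assms(13)] by blast
  \<comment> \<open>Adding the two slope equations and using \<open>m = i * i'\<close> and
    \<open>n = j * j'\<close> shows that the heights sum to \<open>k\<close>.\<close>
  have "real (x + y) * (ln n - ln m) = real k * (ln n - ln m)"
    using x(2) y(2) pos by (simp add: mn ln_mult algebra_simps)
  then have "x + y = k" using \<open>0 < m\<close> \<open>m < n\<close> by simp
  then have cases: "x = 0 \<or> y = 0" using x(1) y(1) \<open>k > 0\<close> by (auto dest!: dvd_imp_le)
  have top: "l \<le> n" if "dirichlet_mult U V l \<noteq> 0" for l
  proof -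
    have "f l \<noteq> 0 \<or> g l \<noteq> 0" using that by (auto simp: UV h_def)
    then show ?thesis
      using nonzero_le_degree[OF assms(1)] nonzero_le_degree[OF assms(4)] assms(3,6,8) by fastforce
  qed
  have one: "z = 1" if "z dvd m" "z dvd n" for z
    using coprime_common_divisor[OF assms(7) that] by simp
  from cases show False
  proof
    assume "x = 0"
    then have "i = j" using x(2) \<open>k > 0\<close> pos by simp
    \<comment> \<open>The degenerate edge sits at a common divisor of the coprime \<open>m\<close>
      and \<open>n\<close>. Hence \<open>j' = n\<close>, and \<open>V\<close> has full
      degree.\<close>
    then have "j = 1" by (intro one) (simp_all add: mn)
    then have "V n \<noteq> 0" using mn e' by (simp add: newton_edge_def)
    then have "dirichlet_constant U"
      using dirichlet_constant_if_cofactor_full_degree[OF U'(1) Unz V'(1) _ _ top] \<open>m < n\<close> by simp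
    with U'(2) show False ..
  next
    assume "y = 0"
    then have "i' = j'" using y(2) \<open>k > 0\<close> pos by simp
    then have "j' = 1" by (intro one) (simp_all add: mn)
    then have "U n \<noteq> 0" using mn e by (simp add: newton_edge_def)
    then have "dirichlet_constant V"
      using dirichlet_constant_if_cofactor_full_degree[OF V'(1) Vnz U'(1)] top \<open>m < n\<close>
      by (simp add: dirichlet_mult_commute[of V U])
    with V'(2) show False ..
  qed
qed

end
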